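(* Let $f$ and $g$ be functions such that either (0-case) $f\in\mathcal{F}$ and $g\in\mathcal{F}_0$, or (1-case) $f\in\mathbb{K}[x^{-1},x]$ and $g\in\mathcal{F}_1$, so that $f\circ g\in\mathcal{F}$. Then for every $h\in\mathcal{F}$: $h=f\circ g$ if and only if $\Phi_n(h)=\Phi_n(f)\circ\Phi_{\bullet}(g)$ for all $n\ge0$; that is, $\Phi_n(h)=\Phi_n(f)(\Phi_1(g),\ldots,\Phi_n(g))$ in the 0-case and $\Phi_n(h)=\Phi_n(f)(\Phi_0(g),\Phi_1(g),\ldots,\Phi_n(g))$ in the 1-case.
   Context: $\mathbb{K}$ is a field of characteristic zero, $\mathcal{F}=\mathbb{K}[[x]]$ with derivation $D$ (extended to Laurent polynomials $\mathbb{K}[x^{-1},x]$), $\mathcal{F}_0$ the series with zero constant term, $\mathcal{F}_1$ those with nonzero constant term; composition $f\circ g=\sum_n([x^n]f)g^n$. Partial Bell polynomials: $B_{0,0}=1$, $B_{n,0}=0$ ($n\ge1$), $B_{n,k}=0$ ($k>n$), and for $1\le k\le n$, $B_{n,k}=\sum\frac{n!}{\prod_ir_i!(i!)^{r_i}}\prod_iX_i^{r_i}$ over non-negative integers with $\sum r_i=k$, $\sum ir_i=n$. Faà di Bruno polynomials: for a power series $u\in\mathcal{F}$, $\Phi_n(u):=\sum_{k=0}^nD^k(u)(0)B_{n,k}$ (so $\Phi_0(u)=u(0)$); for a Laurent polynomial $f$ in the 1-case, $\Phi_n(f):=\sum_{k=0}^nD^k(f)(X_0)B_{n,k}$, a polynomial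 in $X_0^{\pm1},X_1,\ldots,X_n$. $P(H_0,H_1,\ldots)$ denotes substituting $H_j$ for $X_j$. *)

theory Defs
  imports
    "HOL-Computational_Algebra.Formal_Laurent_Series"
    "HOL-Library.Poly_Mapping"
    "HOL-Library.FuncSet"
begin

text \<open>
  Laurent polynomials in the indeterminates \<open>X\<^sub>0, X\<^sub>1, X\<^sub>2, \<dots>\<close>: finitely supported coefficient
  functions on exponent vectors, multiplied by convolution. This common ambient ring contains both
  the polynomial ring in \<open>X\<^sub>1, X\<^sub>2, \<dots>\<close> and the ring of polynomials in
  \<open>X\<^sub>0, X\<^sub>0\<inverse>, X\<^sub>1, X\<^sub>2, \<dots>\<close>.
\<close>

type_synonym 'a lpoly = "(nat \<Rightarrow>\<^sub>0 int) \<Rightarrow>\<^sub>0 'a"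

definition Cst :: "'a::zero \<Rightarrow> 'a lpoly" where
  "Cst c = Poly_Mapping.single 0 c"

definition X_pow :: "nat \<Rightarrow> int \<Rightarrow> 'a::{zero,one} lpoly" where
  "X_pow i e = Poly_Mapping.single (Poly_Mapping.single i e) 1"

abbreviation X :: "nat \<Rightarrow> 'a::{zero,one} lpoly" where
  "X i \<equiv> X_pow i 1"

text \<open>Integer powers in a commutative ring; for negative exponents, meaningful for units only.\<close>

definition unit_inverse :: "'a::comm_ring_1 \<Rightarrow> 'a" where
  "unit_inverse a = (THE b. a * b = 1)"

definition unit_powi :: "'a::comm_ring_1 \<Rightarrow> int \<Rightarrow> 'a" where
  "unit_powi a e = (if 0 \<le> e then a ^ nat e else unit_inverse a ^ nat (- e))"

definition subst :: "'a::comm_ring_1 lpoly \<Rightarrow> (nat \<Rightarrow> 'a lpoly) \<Rightarrow> 'a lpoly" where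
  "subst P H = (\<Sum>m\<in>Poly_Mapping.keys P. Cst (Poly_Mapping.lookup P m) *
     (\<Prod>i\<in>Poly_Mapping.keys m. unit_powi (H i) (Poly_Mapping.lookup m i)))"

definition bell_index :: "nat \<Rightarrow> nat \<Rightarrow> (nat \<Rightarrow> nat) set" where
  "bell_index n k = {r \<in> {1..n} \<rightarrow>\<^sub>E UNIV. (\<Sum>i=1..n. r i) = k \<and> (\<Sum>i=1..n. i * r i) = n}"

definition bell :: "nat \<Rightarrow> nat \<Rightarrow> 'a::field_char_0 lpoly" where
  "bell n k =
     (if k = 0 then (if n = 0 then 1 else 0)
      else if k > n then 0
      else (\<Sum>r\<in>bell_index n k.
              Cst (fact n / (\<Prod>i=1..n. fact (r i) * fact i ^ r i)) * (\<Prod>i=1..n. X i ^ r i)))"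

definition Phi :: "nat \<Rightarrow> 'a::field_char_0 fps \<Rightarrow> 'a lpoly" where
  "Phi n u = (\<Sum>k=0..n. Cst (fps_nth ((fps_deriv ^^ k) u) 0) * bell n k)"

definition laurent_polys :: "'a::zero fls set" where
  "laurent_polys = {f. finite {i. fls_nth f i \<noteq> 0}}"

definition eval_X0 :: "'a::comm_ring_1 fls \<Rightarrow> 'a lpoly" where
  "eval_X0 f = (\<Sum>i | fls_nth f i \<noteq> 0. Cst (fls_nth f i) * X_pow 0 i)"

definition Phi_laurent :: "nat \<Rightarrow> 'a::field_char_0 fls \<Rightarrow> 'a lpoly" where
  "Phi_laurent n f = (\<Sum>k=0..n. eval_X0 ((fls_deriv ^^ k) f) * bell n k)"

text \<open>
  The library's \<open>fls_compose_fps\<close> and \<open>fps_compose\<close> are only meaningful when the inner series has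
  zero constant term, hence a separate composition for Laurent polynomials with inner series of
  nonzero constant term.
\<close>

definition laurent_compose :: "'a::field fls \<Rightarrow> 'a fps \<Rightarrow> 'a fps" where
  "laurent_compose f g = (\<Sum>i | fls_nth f i \<noteq> 0. fps_const (fls_nth f i) * g powi i)"

end

theory Submission
  imports Defs
begin

text \<open>
  Let \<open>X(t) = \<Sum>\<^sub>n\<^sub>\<ge>\<^sub>1 X\<^sub>n t\<^sup>n/n!\<close>. By the multinomial theorem \<open>X(t)\<^sup>k/k! = \<Sum>\<^sub>n B\<^sub>n\<^sub>,\<^sub>k t\<^sup>n/n!\<close>, so
  \<open>\<Sum>\<^sub>n \<Phi>\<^sub>n(u) t\<^sup>n/n! = u \<circ> X(t)\<close>, and substituting \<open>H\<^sub>j\<close> for \<open>X\<^sub>j\<close> merely replaces \<open>X(t)\<close> by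
  \<open>\<Sum>\<^sub>n\<^sub>\<ge>\<^sub>1 H\<^sub>n t\<^sup>n/n!\<close>. For \<open>H\<^sub>j = \<Phi>\<^sub>j(g)\<close> the latter is \<open>(g - g(0)) \<circ> X(t)\<close>, so associativity of
  composition gives \<open>\<Phi>\<^sub>n(f) \<circ> \<Phi>(g) = \<Phi>\<^sub>n(f \<circ> (g - g(0)))\<close>. In the 0-case the inner series is
  \<open>g\<close>; in the 1-case \<open>f\<close> may be replaced by its Taylor series at \<open>g(0)\<close>, whose composition with
  \<open>g - g(0)\<close> is \<open>f \<circ> g\<close>. Finally \<open>u\<close> is determined by \<open>u \<circ> X(t)\<close>, because \<open>X(t)\<close> has nonzero
  linear coefficient over a domain.
\<close>

section \<open>Laurent polynomials in several variables\<close>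

lemma Cst_0 [simp]: "Cst 0 = 0"
  by (simp add: Cst_def)

lemma Cst_1 [simp]: "Cst 1 = 1"
  by (simp add: Cst_def)

lemma Cst_add: "Cst (a + b) = Cst a + Cst b"
  by (simp add: Cst_def single_add)

lemma Cst_diff: "Cst (a - b) = Cst a - Cst b"
  by (simp add: Cst_def single_diff)

lemma Cst_mult: "Cst (a * b) = Cst a * Cst b"
  by (simp add: Cst_def mult_single)

lemma Cst_sum: "Cst (sum f A) = (\<Sum>i\<in>A. Cst (f i))"
  by (induction A rule: infinite_finite_induct) (auto simp: Cst_add)

lemma Cst_prod: "Cst (prod f A) = (\<Prod>i\<in>A. Cst (f i))"
  by (induction A rule: infinite_finite_induct) (auto simp: Cst_mult)

lemma Cst_power: "Cst (a ^ n) = Cst a ^ n"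
  by (induction n) (auto simp: Cst_mult)

lemma Cst_of_nat: "Cst (of_nat n) = of_nat n"
  by (induction n) (auto simp: Cst_add)

lemma Cst_eq_iff [simp]: "Cst a = Cst b \<longleftrightarrow> a = b"
  unfolding Cst_def by (metis lookup_single_eq)

lemma Cst_eq_0_iff [simp]: "Cst a = 0 \<longleftrightarrow> a = 0"
  using Cst_eq_iff[of a 0] by simp

lemma X_power: "(X i :: 'a::comm_semiring_1 lpoly) ^ n = X_pow i (int n)"
proof (induction n)
  case 0
  show ?case
    by (simp add: X_pow_def)
next
  case (Suc n)
  then show ?case
    by (simp add: X_pow_def mult_single flip: single_add)
qed

lemma X_neq_0: "X i \<noteq> (0 :: 'a::zero_neq_one lpoly)"
  unfolding X_pow_def by (metis lookup_single_eq lookup_zero zero_neq_one)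

lemma poly_mapping_eq_sum_single:
  fixes P :: "'a \<Rightarrow>\<^sub>0 'b::comm_monoid_add"
  shows "P = (\<Sum>m\<in>Poly_Mapping.keys P. Poly_Mapping.single m (Poly_Mapping.lookup P m))"
  by (rule poly_mapping_eqI) (simp add: lookup_sum lookup_single when_def in_keys_iff)

lemma prod_X_pow:
  assumes "finite A"
  shows "(\<Prod>i\<in>A. X_pow i (e i) :: 'a::comm_semiring_1 lpoly) =
    Poly_Mapping.single (\<Sum>i\<in>A. Poly_Mapping.single i (e i)) 1"
  using assms by (induction A) (auto simp: X_pow_def mult_single)

lemma lookup_sum_single:
  assumes "finite A"
  shows "Poly_Mapping.lookup (\<Sum>i\<in>A. Poly_Mapping.single i (e i)) j = (if j \<in> A then e j else 0)"
  using assms by (simp add: lookup_sum lookup_single when_def)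

lemma Cst_mult_prod_X_pow:
  fixes c :: "'a::comm_semiring_1"
  assumes "finite A"
  shows "Cst c * (\<Prod>i\<in>A. X_pow i (e i)) =
    Poly_Mapping.single (\<Sum>i\<in>A. Poly_Mapping.single i (e i)) c"
  by (simp add: prod_X_pow[OF assms] Cst_def mult_single)

definition vars :: "'a::zero lpoly \<Rightarrow> nat set" where
  "vars P = (\<Union>m\<in>Poly_Mapping.keys P. Poly_Mapping.keys m)"

lemma vars_Cst [simp]: "vars (Cst c) = {}"
  by (simp add: vars_def Cst_def)

lemma vars_sum_subset: "vars (\<Sum>i\<in>I. P i) \<subseteq> (\<Union>i\<in>I. vars (P i))"
  unfolding vars_def using keys_sum[of P I] by blast

lemma vars_monomial_subset:
  fixes c :: "'a::comm_semiring_1"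
  assumes "finite A"
  shows "vars (Cst c * (\<Prod>i\<in>A. X_pow i (e i))) \<subseteq> A"
  using assms by (auto simp: vars_def Cst_mult_prod_X_pow in_keys_iff lookup_sum_single split: if_splits)

section \<open>Integer powers of units and substitution\<close>

lemma unit_inverse_unique:
  assumes "a * b = 1"
  shows "unit_inverse a = b"
  unfolding unit_inverse_def
proof (rule the_equality)
  show "a * b = 1"
    by (fact assms)
next
  fix c assume "a * c = 1"
  with assms show "c = b"
    by (metis mult.assoc mult.commute mult_1)
qed

lemma unit_powi_0_right [simp]: "unit_powi a 0 = 1"
  by (simp add: unit_powi_def)

lemma unit_powi_of_nat [simp]: "unit_powi a (int n) = a ^ n"
  by (simp add: unit_powi_def)

lemma unit_powi_Cst:
  fixes a :: "'a::field"
  assumes "a \<noteq> 0"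
  shows "unit_powi (Cst a) i = Cst (a powi i)"
proof -
  have "unit_inverse (Cst a) = Cst (inverse a)"
    by (rule unit_inverse_unique) (use assms in \<open>simp flip: Cst_mult\<close>)
  then show ?thesis
    by (simp add: unit_powi_def power_int_def Cst_power)
qed

lemma unit_powi_X: "unit_powi (X i) e = (X_pow i e :: 'a::comm_ring_1 lpoly)"
proof -
  have inverse: "unit_inverse (X i) = (X_pow i (- 1) :: 'a lpoly)"
    by (rule unit_inverse_unique) (simp add: X_pow_def mult_single flip: single_add)
  have "(X_pow i (- 1) :: 'a lpoly) ^ n = X_pow i (- int n)" for n
    by (induction n) (simp_all add: X_pow_def mult_single flip: single_add)
  then show ?thesis
    by (simp add: unit_powi_def inverse X_power)
qed

lemma subst_superset:
  assumes "finite A" "Poly_Mapping.keys P \<subseteq> A"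
  shows "subst P H = (\<Sum>m\<in>A. Cst (Poly_Mapping.lookup P m) *
     (\<Prod>i\<in>Poly_Mapping.keys m. unit_powi (H i) (Poly_Mapping.lookup m i)))"
  unfolding subst_def
  by (rule sum.mono_neutral_left) (use assms in \<open>auto simp: in_keys_iff\<close>)

lemma subst_single:
  "subst (Poly_Mapping.single m c) H =
    Cst c * (\<Prod>i\<in>Poly_Mapping.keys m. unit_powi (H i) (Poly_Mapping.lookup m i))"
  by (subst subst_superset[where A = "{m}"]) auto

lemma subst_Cst: "subst (Cst c) H = Cst c"
  by (simp add: Cst_def[of c] subst_single)

lemma subst_0 [simp]: "subst 0 H = 0"
  by (simp add: subst_def)

lemma subst_add: "subst (P + Q) H = subst P H + subst Q H"
proof -
  let ?A = "Poly_Mapping.keys P \<union> Poly_Mapping.keys Q"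
  have "Poly_Mapping.keys (P + Q) \<subseteq> ?A"
    by (rule Poly_Mapping.keys_add)
  then show ?thesis
    by (simp add: subst_superset[where A = ?A] lookup_add Cst_add distrib_right sum.distrib)
qed

lemma subst_sum: "subst (\<Sum>i\<in>I. P i) H = (\<Sum>i\<in>I. subst (P i) H)"
  by (induction I rule: infinite_finite_induct) (auto simp: subst_add)

lemma subst_monomial:
  assumes "finite A"
  shows "subst (Cst c * (\<Prod>i\<in>A. X_pow i (e i))) H = Cst c * (\<Prod>i\<in>A. unit_powi (H i) (e i))"
proof -
  define m where "m = (\<Sum>i\<in>A. Poly_Mapping.single i (e i))"
  have lookup_m: "Poly_Mapping.lookup m i = (if i \<in> A then e i else 0)" for i
    using assms by (simp add: m_def lookup_sum_single)
  have "(\<Prod>i\<in>Poly_Mapping.keys m. unit_powi (H i) (Poly_Mapping.lookup m i)) =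
      (\<Prod>i\<in>A. unit_powi (H i) (e i))"
    using assms
    by (intro prod.mono_neutral_cong_left) (auto simp: in_keys_iff lookup_m split: if_splits)
  then show ?thesis
    using assms by (simp add: Cst_mult_prod_X_pow subst_single flip: m_def)
qed

lemma subst_single_mult_single:
  assumes "Poly_Mapping.keys m \<inter> Poly_Mapping.keys m' = {}"
  shows "subst (Poly_Mapping.single m c * Poly_Mapping.single m' c') H =
    subst (Poly_Mapping.single m c) H * subst (Poly_Mapping.single m' c') H"
proof -
  let ?pow = "\<lambda>m i. unit_powi (H i) (Poly_Mapping.lookup m i)"
  have lookup_m'_0: "Poly_Mapping.lookup m' i = 0" if "i \<in> Poly_Mapping.keys m" for i
    using assms that by (auto simp: in_keys_iff)
  have lookup_m_0: "Poly_Mapping.lookup m i = 0" if "i \<in> Poly_Mapping.keys m'" for i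
    using assms that by (auto simp: in_keys_iff)
  have keys: "Poly_Mapping.keys (m + m') = Poly_Mapping.keys m \<union> Poly_Mapping.keys m'"
    using lookup_m_0 lookup_m'_0 by (auto simp: in_keys_iff lookup_add)
  have "(\<Prod>i\<in>Poly_Mapping.keys (m + m'). ?pow (m + m') i) =
      (\<Prod>i\<in>Poly_Mapping.keys m. ?pow (m + m') i) * (\<Prod>i\<in>Poly_Mapping.keys m'. ?pow (m + m') i)"
    unfolding keys using assms by (intro prod.union_disjoint) auto
  also have "\<dots> = (\<Prod>i\<in>Poly_Mapping.keys m. ?pow m i) * (\<Prod>i\<in>Poly_Mapping.keys m'. ?pow m' i)"
    by (simp add: lookup_add lookup_m_0 lookup_m'_0)
  finally show ?thesis
    by (simp add: mult_single subst_single Cst_mult mult_ac)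
qed

text \<open>
  Without disjointness, multiplicativity fails: \<open>X\<^sub>i X\<^sub>i\<inverse> = 1\<close>, but \<open>H\<^sub>i\<close> need not be a unit.
\<close>

lemma subst_mult:
  assumes "vars P \<inter> vars Q = {}"
  shows "subst (P * Q) H = subst P H * subst Q H"
proof -
  let ?term = "\<lambda>P m. Poly_Mapping.single m (Poly_Mapping.lookup P m)"
  have sum_terms: "P = sum (?term P) (Poly_Mapping.keys P)" for P
    by (rule poly_mapping_eq_sum_single)
  have "subst (P * Q) H =
      subst ((\<Sum>m\<in>Poly_Mapping.keys P. ?term P m) * (\<Sum>m'\<in>Poly_Mapping.keys Q. ?term Q m')) H"
    by (simp flip: sum_terms)
  also have "\<dots> =
      (\<Sum>m\<in>Poly_Mapping.keys P. \<Sum>m'\<in>Poly_Mapping.keys Q. subst (?term P m * ?term Q m') H)"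
    by (simp only: sum_product subst_sum)
  also have "\<dots> = (\<Sum>m\<in>Poly_Mapping.keys P. \<Sum>m'\<in>Poly_Mapping.keys Q.
      subst (?term P m) H * subst (?term Q m') H)"
    using assms by (intro sum.cong refl subst_single_mult_single) (auto simp: vars_def)
  also have "\<dots> = subst (\<Sum>m\<in>Poly_Mapping.keys P. ?term P m) H *
      subst (\<Sum>m'\<in>Poly_Mapping.keys Q. ?term Q m') H"
    by (simp only: sum_product subst_sum)
  finally show ?thesis
    by (simp flip: sum_terms)
qed

lemma subst_X:
  fixes P :: "'a::comm_ring_1 lpoly"
  shows "subst P X = P"
proof -
  have "(\<Prod>i\<in>Poly_Mapping.keys m. X_pow i (Poly_Mapping.lookup m i) :: 'a lpoly) =
      Poly_Mapping.single m 1" for m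
    by (simp add: prod_X_pow flip: poly_mapping_eq_sum_single)
  then show ?thesis
    by (simp add: subst_def unit_powi_X Cst_def mult_single flip: poly_mapping_eq_sum_single)
qed

section \<open>The multinomial theorem\<close>

definition weak_compositions :: "'i set \<Rightarrow> nat \<Rightarrow> ('i \<Rightarrow> nat) set" where
  "weak_compositions I k = {r \<in> I \<rightarrow>\<^sub>E UNIV. sum r I = k}"

lemma finite_weak_compositions:
  assumes "finite I"
  shows "finite (weak_compositions I k)"
proof (rule finite_subset)
  show "weak_compositions I k \<subseteq> I \<rightarrow>\<^sub>E {..k}"
    using assms
    by (auto simp: weak_compositions_def PiE_iff dest: extensional_arb intro: member_le_sum)
qed (use assms in \<open>auto intro: finite_PiE\<close>)

lemma sum_weak_compositions_insert:
  assumes "finite I" "a \<notin> I"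
  shows "(\<Sum>r\<in>weak_compositions (insert a I) k. f r) =
    (\<Sum>j\<le>k. \<Sum>r\<in>weak_compositions I (k - j). f (r(a := j)))"
proof -
  have sum_upd: "(\<Sum>i\<in>I. if i = a then j else r i) = sum r I" for r :: "'a \<Rightarrow> nat" and j
    using assms by (intro sum.cong) auto
  have "(\<Sum>r\<in>weak_compositions (insert a I) k. f r) =
      (\<Sum>(j, r)\<in>Sigma {..k} (\<lambda>j. weak_compositions I (k - j)). f (r(a := j)))"
    by (rule sum.reindex_bij_witness[where i = "\<lambda>(j, r). r(a := j)"
          and j = "\<lambda>r. (r a, r(a := undefined))"])
       (use assms in \<open>auto simp: weak_compositions_def sum_upd PiE_iff extensional_def fun_eq_iff\<close>)
  then show ?thesis
    using finite_weak_compositions[OF assms(1)] by (simp add: sum.Sigma)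
qed

definition multinomial :: "'i set \<Rightarrow> ('i \<Rightarrow> nat) \<Rightarrow> nat" where
  "multinomial I r = fact (sum r I) div (\<Prod>i\<in>I. fact (r i))"

lemma prod_fact_dvd_fact_sum:
  assumes "finite I"
  shows "(\<Prod>i\<in>I. fact (r i)) dvd (fact (sum r I) :: nat)"
  using assms
proof (induction I)
  case (insert a I)
  then have "(\<Prod>i\<in>insert a I. fact (r i)) dvd fact (r a) * (fact (sum r I) :: nat)"
    by (simp add: mult_dvd_mono)
  also have "\<dots> dvd fact (r a + sum r I)"
    by (rule fact_fact_dvd_fact)
  finally show ?case
    using insert.hyps by simp
qed simp

lemma multinomial_insert:
  assumes "finite I" "a \<notin> I"
  shows "multinomial (insert a I) r = (r a + sum r I choose r a) * multinomial I r"
proof -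
  have "fact (sum r (insert a I)) =
      fact (r a) * (r a + sum r I choose r a) * (fact (sum r I) :: nat)"
    using assms binomial_fact_lemma[of "r a" "r a + sum r I"] by (simp add: mult_ac)
  also have "fact (sum r I) = (\<Prod>i\<in>I. fact (r i)) * multinomial I r"
    using assms by (simp add: multinomial_def prod_fact_dvd_fact_sum)
  finally show ?thesis
    using assms by (simp add: multinomial_def[of "insert a I"])
qed

lemma of_nat_multinomial:
  assumes "finite I"
  shows "of_nat (multinomial I r) = fact (sum r I) / (\<Prod>i\<in>I. fact (r i) :: 'a::field_char_0)"
  using assms
  by (simp add: multinomial_def field_char_0_class.of_nat_div prod_fact_dvd_fact_sum)

lemma multinomial_cong:
  assumes "\<And>i. i \<in> I \<Longrightarrow> r i = s i"
  shows "multinomial I r = multinomial I s"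
  using assms by (simp add: multinomial_def)

lemma multinomial_insert_fun_upd:
  assumes "finite I" "a \<notin> I"
  shows "multinomial (insert a I) (r(a := j)) = (j + sum r I choose j) * multinomial I r"
proof -
  have r_unchanged: "(r(a := j)) i = r i" if "i \<in> I" for i
    using that assms(2) by auto
  have "sum (r(a := j)) I = sum r I"
    by (rule sum.cong) (simp_all only: r_unchanged)
  moreover have "multinomial I (r(a := j)) = multinomial I r"
    by (rule multinomial_cong) (rule r_unchanged)
  ultimately show ?thesis
    using assms by (simp add: multinomial_insert)
qed

theorem multinomial_theorem:
  fixes x :: "'i \<Rightarrow> 'a::comm_semiring_1"
  assumes "finite I"
  shows "(\<Sum>i\<in>I. x i) ^ k =
    (\<Sum>r\<in>weak_compositions I k. of_nat (multinomial I r) * (\<Prod>i\<in>I. x i ^ r i))"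
  using assms
proof (induction I arbitrary: k)
  case empty
  have "weak_compositions {} k = (if k = 0 then {\<lambda>_::'i. undefined} else {})"
    by (auto simp: weak_compositions_def)
  then show ?case
    by (cases k) (simp_all add: multinomial_def)
next
  case (insert a I)
  let ?term = "\<lambda>I r. of_nat (multinomial I r) * (\<Prod>i\<in>I. x i ^ r i)"
  have term_insert: "?term (insert a I) (r(a := j)) =
      of_nat (k choose j) * x a ^ j * ?term I r"
    if "j \<le> k" "r \<in> weak_compositions I (k - j)" for j r
  proof -
    have "(\<Prod>i\<in>I. x i ^ (r(a := j)) i) = (\<Prod>i\<in>I. x i ^ r i)"
      using insert.hyps by (intro prod.cong) auto
    then show ?thesis
      using that insert.hyps
      by (simp add: multinomial_insert_fun_upd weak_compositions_def mult_ac)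
  qed
  have "(\<Sum>i\<in>insert a I. x i) ^ k =
      (\<Sum>j\<le>k. of_nat (k choose j) * x a ^ j * (\<Sum>i\<in>I. x i) ^ (k - j))"
    using insert.hyps by (simp add: binomial_ring)
  also have "\<dots> = (\<Sum>j\<le>k. \<Sum>r\<in>weak_compositions I (k - j).
      of_nat (k choose j) * x a ^ j * ?term I r)"
    by (simp only: insert.IH sum_distrib_left)
  also have "\<dots> = (\<Sum>j\<le>k. \<Sum>r\<in>weak_compositions I (k - j). ?term (insert a I) (r(a := j)))"
    by (intro sum.cong refl) (simp only: term_insert atMost_iff)
  also have "\<dots> = (\<Sum>r\<in>weak_compositions (insert a I) k. ?term (insert a I) r)"
    using insert.hyps by (rule sum_weak_compositions_insert[symmetric])
  finally show ?case .
qed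

section \<open>Powers of power series and Bell polynomials\<close>

lemma bell_index_eq_weak_compositions:
  "bell_index n k = {r \<in> weak_compositions {1..n} k. (\<Sum>i=1..n. i * r i) = n}"
  by (auto simp: bell_index_def weak_compositions_def)

lemma fps_power_nth_cong:
  assumes "\<And>i. i \<le> n \<Longrightarrow> fps_nth a i = fps_nth b i"
  shows "fps_nth (a ^ k) n = fps_nth (b ^ k) n"
  using assms
proof (induction k arbitrary: n)
  case (Suc k)
  then show ?case
    by (auto simp: fps_mult_nth intro!: sum.cong arg_cong2[where f = "(*)"])
qed simp

lemma prod_fps_const:
  fixes a :: "'i \<Rightarrow> 'a::comm_ring_1"
  shows "(\<Prod>i\<in>A. fps_const (a i)) = fps_const (\<Prod>i\<in>A. a i)"
  by (induction A rule: infinite_finite_induct) auto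

lemma fps_power_nth_bell_index:
  fixes f :: "'a::comm_ring_1 fps"
  assumes "fps_nth f 0 = 0"
  shows "fps_nth (f ^ k) n =
    (\<Sum>r\<in>bell_index n k. of_nat (multinomial {1..n} r) * (\<Prod>i=1..n. fps_nth f i ^ r i))"
proof -
  let ?coeff = "\<lambda>r. of_nat (multinomial {1..n} r) * (\<Prod>i=1..n. fps_nth f i ^ r i)"
  define p where "p = (\<Sum>i=1..n. fps_const (fps_nth f i) * fps_X ^ i)"
  have monomial: "of_nat (multinomial {1..n} r) *
        (\<Prod>i=1..n. (fps_const (fps_nth f i) * fps_X ^ i) ^ r i) =
      fps_const (?coeff r) * fps_X ^ (\<Sum>i=1..n. i * r i)" for r
    by (simp add: power_mult_distrib prod.distrib prod_fps_const power_sum mult.assoc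
        flip: power_mult fps_of_nat fps_const_mult)
  have "fps_nth (f ^ k) n = fps_nth (p ^ k) n"
    using assms
    by (intro fps_power_nth_cong)
       (auto simp: p_def fps_sum_nth if_distrib not_less_eq_eq cong: if_cong)
  also have "p ^ k = (\<Sum>r\<in>weak_compositions {1..n} k.
      fps_const (?coeff r) * fps_X ^ (\<Sum>i=1..n. i * r i))"
    unfolding p_def by (simp only: multinomial_theorem[OF finite_atLeastAtMost] monomial)
  also have "fps_nth \<dots> n = (\<Sum>r\<in>weak_compositions {1..n} k.
      if (\<Sum>i=1..n. i * r i) = n then ?coeff r else 0)"
    by (auto simp: fps_sum_nth intro!: sum.cong)
  also have "\<dots> = (\<Sum>r\<in>bell_index n k. ?coeff r)"
    unfolding bell_index_eq_weak_compositions
    by (rule sum.inter_filter[symmetric]) (simp add: finite_weak_compositions)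
  finally show ?thesis .
qed

lemma bell_index_0_right: "bell_index n 0 = (if n = 0 then {\<lambda>_. undefined} else {})"
  by (auto simp: bell_index_def)

lemma bell_index_eq_empty:
  assumes "n < k"
  shows "bell_index n k = {}"
proof (rule equals0I)
  fix r assume "r \<in> bell_index n k"
  then have "(\<Sum>i=1..n. r i) = k" "(\<Sum>i=1..n. i * r i) = n"
    by (auto simp: bell_index_def)
  moreover have "(\<Sum>i=1..n. r i) \<le> (\<Sum>i=1..n. i * r i)"
    by (rule sum_mono) auto
  ultimately show False
    using assms by simp
qed

definition bell_coeff :: "nat \<Rightarrow> (nat \<Rightarrow> nat) \<Rightarrow> 'a::field_char_0" where
  "bell_coeff n r = fact n / (\<Prod>i=1..n. fact (r i) * fact i ^ r i)"

lemma bell_coeff_eq_multinomial: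
  assumes "r \<in> bell_index n k"
  shows "(1 / fact n) * bell_coeff n r =
    (1 / fact k) * of_nat (multinomial {1..n} r) * (\<Prod>i=1..n. (1 / fact i) ^ r i)"
  using assms
  by (simp add: bell_coeff_def of_nat_multinomial bell_index_def prod.distrib power_one_over
      prod_dividef)

lemma bell_eq_sum_monomials:
  "bell n k =
    (\<Sum>r\<in>bell_index n k. Cst (bell_coeff n r) * (\<Prod>i=1..n. X_pow i (int (r i))))"
  by (simp add: bell_def bell_coeff_def bell_index_0_right bell_index_eq_empty X_power)

lemma vars_bell_subset: "vars (bell n k) \<subseteq> {1..n}"
  unfolding bell_eq_sum_monomials
  by (rule order_trans[OF vars_sum_subset UN_least[OF vars_monomial_subset]]) simp

lemma subst_bell:
  "subst (bell n k) H =
    (\<Sum>r\<in>bell_index n k. Cst (bell_coeff n r) * (\<Prod>i=1..n. H i ^ r i))"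
  by (simp add: bell_eq_sum_monomials subst_sum subst_monomial)

section \<open>Exponential generating functions\<close>

definition egf :: "(nat \<Rightarrow> 'a::field_char_0 lpoly) \<Rightarrow> 'a lpoly fps" where
  "egf H = Abs_fps (\<lambda>n. Cst (1 / fact n) * H n)"

definition reduced_egf :: "(nat \<Rightarrow> 'a::field_char_0 lpoly) \<Rightarrow> 'a lpoly fps" where
  "reduced_egf H = egf H - fps_const (H 0)"

lemma egf_nth [simp]: "fps_nth (egf H) n = Cst (1 / fact n) * H n"
  by (simp add: egf_def)

lemma egf_eq_iff: "egf H = egf G \<longleftrightarrow> H = G"
  by (simp add: fps_eq_iff fun_eq_iff)

lemma reduced_egf_nth [simp]:
  "fps_nth (reduced_egf H) n = (if n = 0 then 0 else Cst (1 / fact n) * H n)"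
  by (simp add: reduced_egf_def)

lemma reduced_egf_power:
  "fps_const (Cst (1 / fact k)) * reduced_egf H ^ k = egf (\<lambda>n. subst (bell n k) H)"
proof (rule fps_ext)
  fix n
  let ?H = "\<lambda>r. \<Prod>i=1..n. H i ^ r i"
  let ?egf = "\<lambda>r. \<Prod>i=1..n. fps_nth (reduced_egf H) i ^ r i"
  have summand: "Cst (1 / fact k) * (of_nat (multinomial {1..n} r) * ?egf r) =
      Cst (1 / fact n) * (Cst (bell_coeff n r) * ?H r)"
    if "r \<in> bell_index n k" for r
  proof -
    have "?egf r = Cst (\<Prod>i=1..n. (1 / fact i) ^ r i) * ?H r"
      by (simp add: power_mult_distrib prod.distrib Cst_prod Cst_power)
    then show ?thesis
      by (simp only: bell_coeff_eq_multinomial[OF that] flip: mult.assoc Cst_mult Cst_of_nat)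
  qed
  have "fps_nth (fps_const (Cst (1 / fact k)) * reduced_egf H ^ k) n =
      (\<Sum>r\<in>bell_index n k. Cst (1 / fact k) * (of_nat (multinomial {1..n} r) * ?egf r))"
    by (simp add: fps_power_nth_bell_index sum_distrib_left)
  also have "\<dots> = (\<Sum>r\<in>bell_index n k. Cst (1 / fact n) * (Cst (bell_coeff n r) * ?H r))"
    by (intro sum.cong refl summand)
  also have "\<dots> = fps_nth (egf (\<lambda>n. subst (bell n k) H)) n"
    by (simp add: subst_bell sum_distrib_left)
  finally show "fps_nth (fps_const (Cst (1 / fact k)) * reduced_egf H ^ k) n =
      fps_nth (egf (\<lambda>n. subst (bell n k) H)) n" .
qed

section \<open>Generating functions of the Faa di Bruno polynomials\<close>

definition fps_Cst :: "'a::zero fps \<Rightarrow> 'a lpoly fps" where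
  "fps_Cst u = Abs_fps (\<lambda>n. Cst (fps_nth u n))"

lemma fps_Cst_nth [simp]: "fps_nth (fps_Cst u) n = Cst (fps_nth u n)"
  by (simp add: fps_Cst_def)

lemma fps_Cst_eq_iff: "fps_Cst u = fps_Cst v \<longleftrightarrow> u = v"
  by (simp add: fps_eq_iff)

lemma fps_Cst_const: "fps_Cst (fps_const c) = fps_const (Cst c)"
  by (simp add: fps_eq_iff)

lemma fps_Cst_diff: "fps_Cst (u - v) = fps_Cst u - fps_Cst v"
  by (simp add: fps_eq_iff Cst_diff)

lemma fps_Cst_mult: "fps_Cst (u * v) = fps_Cst u * fps_Cst v"
  by (simp add: fps_eq_iff fps_mult_nth Cst_sum Cst_mult)

lemma fps_Cst_power: "fps_Cst (u ^ k) = fps_Cst u ^ k"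
  by (induction k) (simp_all add: fps_Cst_mult fps_eq_iff[of _ 1])

lemma fps_Cst_compose: "fps_Cst (u oo v) = fps_Cst u oo fps_Cst v"
  by (simp add: fps_eq_iff fps_compose_nth Cst_sum Cst_mult flip: fps_Cst_power)

lemma subst_Phi:
  "subst (Phi n u) H = (\<Sum>k=0..n. Cst (fact k * fps_nth u k) * subst (bell n k) H)"
  by (simp add: Phi_def fps_0th_higher_deriv subst_sum subst_mult subst_Cst)

lemma egf_subst_Phi: "egf (\<lambda>n. subst (Phi n u) H) = fps_Cst u oo reduced_egf H"
proof (rule fps_ext)
  fix n
  have summand: "Cst (1 / fact n) * (Cst (fact k * fps_nth u k) * subst (bell n k) H) =
      Cst (fps_nth u k) * fps_nth (reduced_egf H ^ k) n" for k
  proof -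
    have "Cst (1 / fact n) * subst (bell n k) H =
        Cst (1 / fact k) * fps_nth (reduced_egf H ^ k) n"
      using reduced_egf_power[of k H] by (simp add: fps_eq_iff)
    then have "Cst (1 / fact n) * (Cst (fact k * fps_nth u k) * subst (bell n k) H) =
        Cst (fact k * fps_nth u k * (1 / fact k)) * fps_nth (reduced_egf H ^ k) n"
      by (simp only: Cst_mult mult.left_commute mult.assoc)
    then show ?thesis
      by simp
  qed
  show "fps_nth (egf (\<lambda>n. subst (Phi n u) H)) n = fps_nth (fps_Cst u oo reduced_egf H) n"
    by (simp add: subst_Phi sum_distrib_left fps_compose_nth summand)
qed

lemma egf_Phi: "egf (\<lambda>n. Phi n u) = fps_Cst u oo reduced_egf X"
  using egf_subst_Phi[of u X] by (simp add: subst_X)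

lemma Phi_eq_iff: "(\<forall>n. Phi n u = Phi n v) \<longleftrightarrow> u = v"
proof
  assume "\<forall>n. Phi n u = Phi n v"
  then have "fps_Cst u oo reduced_egf X = fps_Cst v oo reduced_egf X"
    by (simp flip: egf_Phi)
  then show "u = v"
    by (simp add: fps_compose_inj_right X_neq_0 fps_Cst_eq_iff)
qed simp

lemma Phi_0_left: "Phi 0 u = Cst (fps_nth u 0)"
  by (simp add: Phi_def bell_def)

lemma reduced_egf_Phi:
  "reduced_egf (\<lambda>n. Phi n g) = fps_Cst (g - fps_const (fps_nth g 0)) oo reduced_egf X"
  by (simp add: reduced_egf_def[of "\<lambda>n. Phi n g"] egf_Phi Phi_0_left fps_Cst_diff fps_Cst_const
      fps_compose_sub_distrib)

lemma subst_Phi_Phi: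
  "subst (Phi n f) (\<lambda>j. Phi j g) = Phi n (f oo (g - fps_const (fps_nth g 0)))"
proof -
  let ?g = "g - fps_const (fps_nth g 0)"
  have "egf (\<lambda>n. subst (Phi n f) (\<lambda>j. Phi j g)) = fps_Cst f oo (fps_Cst ?g oo reduced_egf X)"
    by (simp only: egf_subst_Phi reduced_egf_Phi)
  also have "\<dots> = (fps_Cst f oo fps_Cst ?g) oo reduced_egf X"
    by (rule fps_compose_assoc) simp_all
  also have "\<dots> = egf (\<lambda>n. Phi n (f oo ?g))"
    by (simp only: egf_Phi fps_Cst_compose)
  finally show ?thesis
    by (simp add: egf_eq_iff fun_eq_iff)
qed

section \<open>Laurent polynomials in one variable\<close>

lemma fps_powi_nth_0: "fps_nth (b powi i) 0 = (fps_nth b 0 :: 'a::field) powi i"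
  by (simp add: power_int_def fps_power_zeroth)

lemma fps_powi_compose:
  fixes b c :: "'a::field fps"
  assumes "fps_nth b 0 \<noteq> 0" "fps_nth c 0 = 0"
  shows "b powi i oo c = (b oo c) powi i"
  using assms by (simp add: power_int_def fps_compose_power[symmetric] fps_inverse_compose)

lemma fps_deriv_powi:
  fixes b :: "'a::field fps"
  assumes "fps_nth b 0 \<noteq> 0"
  shows "fps_deriv (b powi i) = of_int i * b powi (i - 1) * fps_deriv b"
proof (cases i rule: int_cases)
  case (nonneg n)
  then show ?thesis
    by (cases n)
       (simp_all add: power_int_def nat_add_distrib fps_deriv_power' mult_ac del: power_Suc)
next
  case (neg n)
  then have "b powi i = inverse b ^ Suc n" "b powi (i - 1) = inverse b ^ n * (inverse b)\<^sup>2"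
      "of_int i = (- of_nat (Suc n) :: 'a fps)"
    by (simp_all add: power_int_def nat_add_distrib power2_eq_square mult_ac)
  then show ?thesis
    by (simp only: fps_deriv_power' fps_inverse_deriv[OF assms] diff_Suc_1
        mult_minus_left mult_minus_right mult_ac)
qed

lemma fls_deriv_support_subset:
  fixes f :: "'a::ring_1 fls"
  shows "{i. fls_nth (fls_deriv f) i \<noteq> 0} \<subseteq> (\<lambda>i. i - 1) ` {i. fls_nth f i \<noteq> 0}"
  by (auto simp: image_iff) (metis add_diff_cancel_right' mult_zero_right)

lemma fls_deriv_in_laurent_polys:
  fixes f :: "'a::ring_1 fls"
  assumes "f \<in> laurent_polys"
  shows "fls_deriv f \<in> laurent_polys"
  using assms finite_subset[OF fls_deriv_support_subset[of f]]
  by (simp add: laurent_polys_def del: fls_deriv_nth)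

lemma laurent_compose_superset:
  assumes "finite A" "{i. fls_nth f i \<noteq> 0} \<subseteq> A"
  shows "laurent_compose f g = (\<Sum>i\<in>A. fps_const (fls_nth f i) * g powi i)"
  unfolding laurent_compose_def by (rule sum.mono_neutral_left) (use assms in auto)

lemma fps_deriv_laurent_compose:
  fixes f :: "'a::field fls"
  assumes "f \<in> laurent_polys" "fps_nth g 0 \<noteq> 0"
  shows "fps_deriv (laurent_compose f g) = laurent_compose (fls_deriv f) g * fps_deriv g"
proof -
  let ?S = "{i. fls_nth f i \<noteq> 0}"
  have "laurent_compose (fls_deriv f) g =
      (\<Sum>i\<in>(\<lambda>i. i - 1) ` ?S. fps_const (fls_nth (fls_deriv f) i) * g powi i)"
    using assms(1)
    by (intro laurent_compose_superset fls_deriv_support_subset) (auto simp: laurent_polys_def)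
  also have "\<dots> = (\<Sum>i\<in>?S. fps_const (of_int i * fls_nth f i) * g powi (i - 1))"
    by (subst sum.reindex) (auto simp: inj_on_def)
  finally have "laurent_compose (fls_deriv f) g * fps_deriv g =
      (\<Sum>i\<in>?S. fps_const (of_int i * fls_nth f i) * g powi (i - 1) * fps_deriv g)"
    by (simp only: sum_distrib_right)
  also have "\<dots> = fps_deriv (laurent_compose f g)"
    unfolding laurent_compose_def fps_deriv_sum
    by (rule sum.cong)
       (simp_all add: fps_deriv_powi assms fps_of_int mult_ac flip: fps_const_mult)
  finally show ?thesis
    by simp
qed

lemma laurent_compose_compose:
  fixes f :: "'a::field fls"
  assumes "fps_nth b 0 \<noteq> 0" "fps_nth c 0 = 0"
  shows "laurent_compose f b oo c = laurent_compose f (b oo c)"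
  using assms
  by (simp add: laurent_compose_def fps_compose_sum_distrib fps_compose_mult_distrib fps_powi_compose)

definition laurent_taylor :: "'a::field fls \<Rightarrow> 'a \<Rightarrow> 'a fps" where
  "laurent_taylor f a = laurent_compose f (fps_const a + fps_X)"

lemma laurent_taylor_nth_0:
  "fps_nth (laurent_taylor f a) 0 = (\<Sum>i | fls_nth f i \<noteq> 0. fls_nth f i * a powi i)"
  by (simp add: laurent_taylor_def laurent_compose_def fps_sum_nth fps_powi_nth_0)

lemma laurent_taylor_compose:
  assumes "fps_nth g 0 \<noteq> 0"
  shows "laurent_taylor f (fps_nth g 0) oo (g - fps_const (fps_nth g 0)) = laurent_compose f g"
proof -
  have "(fps_const (fps_nth g 0) + fps_X) oo (g - fps_const (fps_nth g 0)) = g"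
    by (simp add: fps_compose_add_distrib)
  with assms show ?thesis
    by (simp add: laurent_taylor_def laurent_compose_compose)
qed

lemma higher_deriv_laurent_taylor:
  assumes "f \<in> laurent_polys" "a \<noteq> 0"
  shows "(fps_deriv ^^ k) (laurent_taylor f a) = laurent_taylor ((fls_deriv ^^ k) f) a"
proof -
  have "(fls_deriv ^^ k) f \<in> laurent_polys" for k
    by (induction k) (simp_all add: assms fls_deriv_in_laurent_polys)
  then show ?thesis
    using assms(2)
    by (induction k) (simp_all add: laurent_taylor_def fps_deriv_laurent_compose)
qed

lemma vars_eval_X0_subset: "vars (eval_X0 f) \<subseteq> {0}"
proof -
  have "vars (Cst c * X_pow 0 i) \<subseteq> {0}" for c :: 'a and i
    using vars_monomial_subset[of "{0}" c "\<lambda>_. i"] by simp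
  then show ?thesis
    unfolding eval_X0_def by (rule order_trans[OF vars_sum_subset UN_least])
qed

lemma subst_eval_X0:
  "subst (eval_X0 f) H = (\<Sum>i | fls_nth f i \<noteq> 0. Cst (fls_nth f i) * unit_powi (H 0) i)"
proof -
  have "subst (Cst c * X_pow 0 i) H = Cst c * unit_powi (H 0) i" for c i
    using subst_monomial[of "{0}" c "\<lambda>_. i"] by simp
  then show ?thesis
    by (simp add: eval_X0_def subst_sum)
qed

lemma subst_Phi_laurent:
  assumes f: "f \<in> laurent_polys" and a: "a \<noteq> 0" and H: "H 0 = Cst a"
  shows "subst (Phi_laurent n f) H = subst (Phi n (laurent_taylor f a)) H"
proof -
  have "subst (eval_X0 q * bell n k) H =
      Cst (fps_nth (laurent_taylor q a) 0) * subst (bell n k) H" for q k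
  proof -
    have "vars (eval_X0 q) \<inter> vars (bell n k :: 'a lpoly) = {}"
      using vars_eval_X0_subset[of q] vars_bell_subset[of n k] by fastforce
    moreover have "subst (eval_X0 q) H = Cst (fps_nth (laurent_taylor q a) 0)"
      by (simp add: subst_eval_X0 H unit_powi_Cst[OF a] laurent_taylor_nth_0 Cst_sum Cst_mult)
    ultimately show ?thesis
      by (simp add: subst_mult)
  qed
  then show ?thesis
    by (simp add: Phi_laurent_def Phi_def subst_sum subst_mult subst_Cst
        higher_deriv_laurent_taylor[OF f a])
qed

lemma subst_Phi_laurent_Phi:
  assumes "f \<in> laurent_polys" "fps_nth g 0 \<noteq> 0"
  shows "subst (Phi_laurent n f) (\<lambda>j. Phi j g) = Phi n (laurent_compose f g)"
proof -
  have "subst (Phi_laurent n f) (\<lambda>j. Phi j g) =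
      subst (Phi n (laurent_taylor f (fps_nth g 0))) (\<lambda>j. Phi j g)"
    by (rule subst_Phi_laurent[OF assms]) (rule Phi_0_left)
  then show ?thesis
    by (simp add: subst_Phi_Phi laurent_taylor_compose assms(2))
qed

theorem theorem4p11:
  fixes g h :: "'a::field_char_0 fps"
  shows "(\<forall>f :: 'a fps. fps_nth g 0 = 0 \<longrightarrow>
            (h = f oo g \<longleftrightarrow> (\<forall>n. Phi n h = subst (Phi n f) (\<lambda>j. Phi j g)))) \<and>
         (\<forall>f \<in> (laurent_polys :: 'a fls set). fps_nth g 0 \<noteq> 0 \<longrightarrow>
            (h = laurent_compose f g \<longleftrightarrow>
              (\<forall>n. Phi n h = subst (Phi_laurent n f) (\<lambda>j. Phi j g))))"
proof (intro conjI allI ballI impI)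
  fix f :: "'a fps"
  assume "fps_nth g 0 = 0"
  then have "subst (Phi n f) (\<lambda>j. Phi j g) = Phi n (f oo g)" for n
    by (simp add: subst_Phi_Phi)
  then show "h = f oo g \<longleftrightarrow> (\<forall>n. Phi n h = subst (Phi n f) (\<lambda>j. Phi j g))"
    by (simp add: Phi_eq_iff)
next
  fix f :: "'a fls"
  assume "f \<in> laurent_polys" "fps_nth g 0 \<noteq> 0"
  then have "subst (Phi_laurent n f) (\<lambda>j. Phi j g) = Phi n (laurent_compose f g)" for n
    by (rule subst_Phi_laurent_Phi)
  then show "h = laurent_compose f g \<longleftrightarrow>
      (\<forall>n. Phi n h = subst (Phi_laurent n f) (\<lambda>j. Phi j g))"
    by (simp add: Phi_eq_iff)
qed

end
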